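(* Suppose $\{W_1,\ldots,W_f\}$ is a set of mutually quasi-unbiased weighing matrices for parameters $(d,k,l,a)$. Then $\{\frac{1}{\sqrt a}W_2W_1^T,\ldots,\frac{1}{\sqrt a}W_fW_1^T\}$ is a set of mutually unbiased weighing matrices of weight $l$.
   Context: A weighing matrix of order $d$ and weight $k$ is a $d\times d$ matrix $W$ with entries in $\{0,\pm1\}$ with $WW^T=kI$. Two weighing matrices $W_1,W_2$ of order $d$ and weight $k$ are quasi-unbiased for parameters $(d,k,l,a)$ (with $a,l$ positive integers) if $\frac{1}{\sqrt a}W_1W_2^T$ is a weighing matrix of weight $l$ (so $l=k^2/a$). A set is mutually quasi-unbiased for $(d,k,l,a)$ if any two distinct members are quasi-unbiased for $(d,k,l,a)$. Two weighing matrices $V_1,V_2$ of weight $l$ are unbiased if $\frac{1}{\sqrt l}V_1V_2^T$ is a weighing matrix of weight $l$; a set is mutually unbiased if any two distinct members are unbiased. *)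

theory Defs
  imports "HOL-Analysis.Analysis"
begin

text \<open>The order \<open>d\<close> of a matrix is \<open>CARD('n)\<close>. Matrices are taken over the reals since
  the notions below rescale by \<open>1 / sqrt a\<close>.\<close>

definition weighing_matrix :: "nat \<Rightarrow> real^'n^'n \<Rightarrow> bool" where
  "weighing_matrix k W \<longleftrightarrow>
     (\<forall>i j. W $ i $ j \<in> {0, 1, -1}) \<and> W ** transpose W = mat (real k)"

definition quasi_unbiased :: "nat \<Rightarrow> nat \<Rightarrow> nat \<Rightarrow> real^'n^'n \<Rightarrow> real^'n^'n \<Rightarrow> bool" where
  "quasi_unbiased k l a W1 W2 \<longleftrightarrow>
     0 < a \<and> 0 < l \<and> weighing_matrix k W1 \<and> weighing_matrix k W2 \<and>
     weighing_matrix l ((1 / sqrt (real a)) *\<^sub>R (W1 ** transpose W2))"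

definition mutually_quasi_unbiased :: "nat \<Rightarrow> nat \<Rightarrow> nat \<Rightarrow> (real^'n^'n) set \<Rightarrow> bool" where
  "mutually_quasi_unbiased k l a S \<longleftrightarrow>
     (\<forall>W\<in>S. weighing_matrix k W) \<and> pairwise (quasi_unbiased k l a) S"

definition unbiased :: "nat \<Rightarrow> real^'n^'n \<Rightarrow> real^'n^'n \<Rightarrow> bool" where
  "unbiased l V1 V2 \<longleftrightarrow>
     weighing_matrix l V1 \<and> weighing_matrix l V2 \<and>
     weighing_matrix l ((1 / sqrt (real l)) *\<^sub>R (V1 ** transpose V2))"

definition mutually_unbiased :: "nat \<Rightarrow> (real^'n^'n) set \<Rightarrow> bool" where
  "mutually_unbiased l S \<longleftrightarrow>
     (\<forall>V\<in>S. weighing_matrix l V) \<and> pairwise (unbiased l) S"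

end

theory Submission imports Defs begin

text \<open>Write \<open>V\<^sub>i = W\<^sub>i W\<^sub>1\<^sup>T / \<surd>a\<close>. As \<open>k \<noteq> 0\<close>, the relation \<open>W\<^sub>1 W\<^sub>1\<^sup>T = k I\<close> also gives
  \<open>W\<^sub>1\<^sup>T W\<^sub>1 = k I\<close>, so \<open>V\<^sub>i V\<^sub>j\<^sup>T = (k / a) W\<^sub>i W\<^sub>j\<^sup>T\<close>. For \<open>i = j\<close> this yields \<open>l a = k\<^sup>2\<close>; for
  \<open>i \<noteq> j\<close> it then says that \<open>V\<^sub>i V\<^sub>j\<^sup>T / \<surd>l\<close> equals \<open>W\<^sub>i W\<^sub>j\<^sup>T / \<surd>a\<close>, a weighing matrix of weight
  \<open>l\<close> by hypothesis. Multiplying \<open>V\<^sub>i\<close> by \<open>W\<^sub>1\<close> recovers \<open>W\<^sub>i\<close> up to a nonzero factor.\<close>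

lemma mat_eq_scaleR: "mat c = c *\<^sub>R (mat 1 :: real^'n^'n)"
  by (simp add: mat_def vec_eq_iff)

lemma transpose_scaleR: "transpose (c *\<^sub>R A) = c *\<^sub>R transpose (A :: real^'n^'m)"
  by (simp add: transpose_def vec_eq_iff)

lemma weighing_matrix_gram:
  assumes "weighing_matrix k W"
  shows "W ** transpose W = real k *\<^sub>R mat 1"
  using assms unfolding weighing_matrix_def by (metis mat_eq_scaleR)

text \<open>For a square matrix a right inverse is also a left inverse; here the inverse of
  \<open>W\<close> is \<open>transpose W\<close> scaled by \<open>1 / k\<close>.\<close>

lemma weighing_matrix_gram_transpose:
  fixes W :: "real^'n^'n"
  assumes "weighing_matrix k W" "k \<noteq> 0"
  shows "transpose W ** W = real k *\<^sub>R mat 1"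
proof -
  have "W ** ((1 / real k) *\<^sub>R transpose W) = mat 1"
    using assms by (simp add: matrix_scalar_ac weighing_matrix_gram flip: scalar_matrix_assoc)
  then have "((1 / real k) *\<^sub>R transpose W) ** W = mat 1"
    by (simp add: matrix_left_right_inverse)
  then have "(1 / real k) *\<^sub>R (transpose W ** W) = mat 1"
    by (simp add: scalar_matrix_assoc)
  then have "real k *\<^sub>R ((1 / real k) *\<^sub>R (transpose W ** W)) = real k *\<^sub>R mat 1"
    by simp
  then show ?thesis using assms(2) by simp
qed

text \<open>The diagonal entries of \<open>W ** transpose W\<close> are the sums of squares of the
  rows, so they all vanish only for \<open>W = 0\<close>.\<close>

lemma weighing_matrix_0_iff:
  fixes W :: "real^'n^'n"
  assumes "weighing_matrix k W"
  shows "k = 0 \<longleftrightarrow> W = 0"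
proof
  assume "k = 0"
  have "(\<Sum>j\<in>UNIV. (W $ i $ j)\<^sup>2) = 0" for i
  proof -
    have "(W ** transpose W) $ i $ i = 0"
      using weighing_matrix_gram[OF assms] \<open>k = 0\<close> by simp
    then show ?thesis
      by (simp add: matrix_matrix_mult_def transpose_def power2_eq_square)
  qed
  then show "W = 0"
    by (simp add: sum_nonneg_eq_0_iff vec_eq_iff)
next
  assume "W = 0"
  then have "real k *\<^sub>R (mat 1 :: real^'n^'n) = 0"
    using weighing_matrix_gram[OF assms] by simp
  then have "(real k *\<^sub>R (mat 1 :: real^'n^'n)) $ i $ i = 0" for i
    by (simp only: zero_index)
  then show "k = 0" by (simp add: mat_def)
qed

text \<open>Positivity of \<open>l\<close> excludes \<open>k = 0\<close>, since
  \<open>W1 = 0\<close> would make the product a zero matrix of weight \<open>l\<close>. This is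
  what makes the matrices invertible.\<close>

lemma quasi_unbiased_weight_nonzero:
  fixes W1 W2 :: "real^'n^'n"
  assumes "quasi_unbiased k l a W1 W2"
  shows "k \<noteq> 0"
proof
  assume "k = 0"
  then have "W1 = 0"
    using assms weighing_matrix_0_iff unfolding quasi_unbiased_def by blast
  then have "weighing_matrix l (0 :: real^'n^'n)"
    using assms unfolding quasi_unbiased_def by simp
  then have "l = 0" using weighing_matrix_0_iff by blast
  with assms show False unfolding quasi_unbiased_def by simp
qed

text \<open>The inner factor \<open>transpose W ** W\<close> collapses to a scalar. \<open>U\<close>
  and \<open>V\<close> are left arbitrary so that both \<open>U = V\<close> and distinct members are
  covered.\<close>

lemma normalized_product_gram:
  fixes U V W :: "real^'n^'n"
  assumes "weighing_matrix k W" "k \<noteq> 0"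
  shows "((1 / sqrt (real a)) *\<^sub>R (U ** transpose W)) **
           transpose ((1 / sqrt (real a)) *\<^sub>R (V ** transpose W)) =
         (real k / real a) *\<^sub>R (U ** transpose V)"
proof -
  have "(U ** transpose W) ** transpose (V ** transpose W) =
        U ** (transpose W ** W) ** transpose V"
    by (simp add: matrix_transpose_mul matrix_mul_assoc)
  also have "\<dots> = real k *\<^sub>R (U ** transpose V)"
    by (simp add: weighing_matrix_gram_transpose[OF assms] matrix_scalar_ac
        flip: scalar_matrix_assoc)
  finally show ?thesis
    by (simp add: transpose_scaleR matrix_scalar_ac flip: scalar_matrix_assoc)
qed

lemma quasi_unbiased_weight_eq:
  fixes W1 W2 :: "real^'n^'n"
  assumes "quasi_unbiased k l a W1 W2"
  shows "real l * real a = (real k)\<^sup>2"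
proof -
  note k = quasi_unbiased_weight_nonzero[OF assms]
  have W: "weighing_matrix k W1" "weighing_matrix k W2" "0 < a"
    and V: "weighing_matrix l ((1 / sqrt (real a)) *\<^sub>R (W1 ** transpose W2))"
    using assms by (auto simp: quasi_unbiased_def)
  \<comment> \<open>The Gram matrix of the normalized product is computed twice: from its weight
    \<open>l\<close>, and by cancelling the middle factor \<open>W2\<close>.\<close>
  have "real l *\<^sub>R (mat 1 :: real^'n^'n) = (real k / real a) *\<^sub>R (real k *\<^sub>R mat 1)"
    using normalized_product_gram[OF W(2) k, of a W1 W1]
      weighing_matrix_gram[OF V] weighing_matrix_gram[OF W(1)] by simp
  then have "(real l *\<^sub>R (mat 1 :: real^'n^'n)) $ i $ i =
             ((real k / real a) *\<^sub>R (real k *\<^sub>R (mat 1 :: real^'n^'n))) $ i $ i" for i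
    by (simp only:)
  then have "real l = real k / real a * real k" by (simp add: mat_def)
  then show ?thesis using W(3) by (simp add: field_simps power2_eq_square)
qed

lemma quasi_unbiased_imp_unbiased:
  fixes U V W :: "real^'n^'n"
  assumes UW: "quasi_unbiased k l a U W" and VW: "quasi_unbiased k l a V W"
    and UV: "quasi_unbiased k l a U V"
  shows "unbiased l ((1 / sqrt (real a)) *\<^sub>R (U ** transpose W))
                    ((1 / sqrt (real a)) *\<^sub>R (V ** transpose W))"
proof -
  have W: "weighing_matrix k W" and a: "0 < a" and l: "0 < l"
    using UW by (auto simp: quasi_unbiased_def)
  have "sqrt (real l) * sqrt (real a) = real k"
    using quasi_unbiased_weight_eq[OF UW] by (simp flip: real_sqrt_mult)
  \<comment> \<open>Substituting \<open>k\<close> as the product of the two roots cancels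
    \<open>sqrt l\<close>.\<close>
  then have "1 / sqrt (real l) * (real k / real a) = sqrt (real a) / real a"
    using a l by (auto simp: field_simps)
  also have "\<dots> = 1 / sqrt (real a)"
    by (simp add: sqrt_divide_self_eq inverse_eq_divide)
  finally have "(1 / sqrt (real l)) *\<^sub>R ((real k / real a) *\<^sub>R (U ** transpose V)) =
      (1 / sqrt (real a)) *\<^sub>R (U ** transpose V)"
    by (metis scaleR_scaleR)
  then show ?thesis
    using assms
    unfolding unbiased_def normalized_product_gram[OF W quasi_unbiased_weight_nonzero[OF UW]]
    by (simp only: quasi_unbiased_def)
qed

text \<open>Right multiplication by \<open>W\<close> undoes \<open>transpose W\<close> up to the
  factor \<open>k\<close>. This keeps the new family free of repetitions.\<close>

lemma normalized_product_cancel: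
  fixes U V W :: "real^'n^'n"
  assumes "weighing_matrix k W" "k \<noteq> 0" "0 < a"
    and "(1 / sqrt (real a)) *\<^sub>R (U ** transpose W) = (1 / sqrt (real a)) *\<^sub>R (V ** transpose W)"
  shows "U = V"
proof -
  have "U ** transpose W = V ** transpose W"
    using assms(3,4) by simp
  then have "U ** (transpose W ** W) = V ** (transpose W ** W)"
    by (simp add: matrix_mul_assoc)
  then have "real k *\<^sub>R U = real k *\<^sub>R V"
    by (simp add: weighing_matrix_gram_transpose[OF assms(1,2)] matrix_scalar_ac
        flip: scalar_matrix_assoc)
  then show ?thesis using assms(2) by simp
qed

theorem theorem3p1:
  fixes W :: "nat \<Rightarrow> real^'n^'n" and f k l a :: nat
  assumes "inj_on W {1..f}"
    and "mutually_quasi_unbiased k l a (W ` {1..f})"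
  shows "inj_on (\<lambda>i. (1 / sqrt (real a)) *\<^sub>R (W i ** transpose (W 1))) {2..f} \<and>
         mutually_unbiased l ((\<lambda>i. (1 / sqrt (real a)) *\<^sub>R (W i ** transpose (W 1))) ` {2..f})"
proof
  let ?V = "\<lambda>i. (1 / sqrt (real a)) *\<^sub>R (W i ** transpose (W 1))"
  have qu: "quasi_unbiased k l a (W i) (W j)" if "i \<in> {1..f}" "j \<in> {1..f}" "i \<noteq> j" for i j
  proof -
    \<comment> \<open>\<open>pairwise\<close> only relates distinct matrices, so distinct indices
      must first give distinct members.\<close>
    have "W i \<noteq> W j" using that assms(1) by (auto dest: inj_onD)
    then show ?thesis
      using that assms(2) unfolding mutually_quasi_unbiased_def pairwise_def by blast
  qed
  have qu1: "quasi_unbiased k l a (W i) (W 1)" if "i \<in> {2..f}" for i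
    using that by (intro qu) auto
  show "inj_on ?V {2..f}"
  proof (rule inj_onI)
    fix i j assume ij: "i \<in> {2..f}" "j \<in> {2..f}" "?V i = ?V j"
    have "weighing_matrix k (W 1)" "0 < a"
      using qu1[OF ij(1)] by (auto simp: quasi_unbiased_def)
    then have "W i = W j"
      using normalized_product_cancel quasi_unbiased_weight_nonzero[OF qu1[OF ij(1)]] ij(3)
      by blast
    then show "i = j" using ij(1,2) assms(1) by (auto dest: inj_onD)
  qed
  have "unbiased l (?V i) (?V j)" if "i \<in> {2..f}" "j \<in> {2..f}" "i \<noteq> j" for i j
    using that by (intro quasi_unbiased_imp_unbiased[OF qu1 qu1 qu]) auto
  \<comment> \<open>Distinct matrices in the image come from distinct indices.\<close>
  then have "pairwise (unbiased l) (?V ` {2..f})"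
    unfolding pairwise_def by blast
  moreover have "weighing_matrix l (?V i)" if "i \<in> {2..f}" for i
    using qu1[OF that] by (simp add: quasi_unbiased_def)
  ultimately show "mutually_unbiased l (?V ` {2..f})"
    unfolding mutually_unbiased_def by blast
qed

end
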